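(* Let $(x,y,m)$ be any solution (not necessarily primitive) of $7x^2+59y^2=3^m$. Then $x$ is odd and $y$ is even.
   Context: A solution of $7x^2+59y^2=3^m$ means a triple $(x,y,m)$ of non-zero integers with $m>0$ satisfying the equation. *)

theory Defs
  imports Main
begin

definition is_solution :: "int \<Rightarrow> int \<Rightarrow> int \<Rightarrow> bool" where
  "is_solution x y m \<longleftrightarrow>
     x \<noteq> 0 \<and> y \<noteq> 0 \<and> m > 0 \<and> 7 * x ^ 2 + 59 * y ^ 2 = 3 ^ nat m"

end

theory Submission
  imports Defs "HOL-Computational_Algebra.Primes"
begin

text \<open>
  No congruence condition excludes an odd \<open>y\<close>; the reason is that all solutions come from the
  smallest one, \<open>7 \<cdot> 1\<^sup>2 + 59 \<cdot> 2\<^sup>2 = 3\<^sup>5\<close>.  Put \<open>z = \<surd>7 + 2\<surd>-59\<close>, an element of norm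
  \<open>3\<^sup>5\<close>.  Multiplication by \<open>z\<close> or its conjugate exchanges the elements \<open>x\<surd>7 + y\<surd>-59\<close>, whose
  norm is \<open>7x\<^sup>2 + 59y\<^sup>2\<close>, with the elements \<open>u + v\<surd>-413\<close>, whose norm is \<open>u\<^sup>2 + 413v\<^sup>2\<close>.

  Since 3 splits in the field of \<open>\<surd>-413\<close>, an element of norm \<open>3\<^sup>m\<close> with \<open>m \<ge> 5\<close> is
  divisible by 3, by \<open>z\<close> or by the conjugate of \<open>z\<close>.  Each of these divisions lowers the exponent
  and preserves the parity of the second coordinate, because \<open>z\<close> has an odd first and an even
  second coordinate and all denominators are powers of 3.  So the second coordinate
  is even for both forms by a simultaneous descent on \<open>m\<close>, which ends at the exponents below 5,
  where the few candidates with an odd second coordinate are excluded by inspection.  The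
  descent can lead to a coordinate 0, as in \<open>3\<^sup>0 = 1\<^sup>2 + 413 \<cdot> 0\<^sup>2\<close>, so its invariant speaks of all
  integer representations.
\<close>

lemma prime_power_dvd_mult_cases:
  fixes p a b :: int
  assumes "prime p" and "p ^ n dvd a * b" and "\<not> (p dvd a \<and> p dvd b)"
  shows "p ^ n dvd a \<or> p ^ n dvd b"
proof (cases "p dvd a")
  case True
  with assms have "coprime (p ^ n) b"
    by (simp add: prime_imp_coprime)
  with assms(2) show ?thesis
    by (simp add: coprime_dvd_mult_left_iff)
next
  case False
  with assms have "coprime (p ^ n) a"
    by (simp add: prime_imp_coprime)
  with assms(2) show ?thesis
    by (simp add: coprime_dvd_mult_right_iff)
qed

lemma both_divisible_by_3:
  fixes a b c d :: int
  assumes "3 dvd c * b - d * a" and "3 dvd c * b + d * a"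
    and "\<not> 3 dvd c" and "\<not> 3 dvd d"
  shows "3 dvd a \<and> 3 dvd b"
proof -
  have three: "prime (3 :: int)"
    by simp
  from dvd_add[OF assms(1,2)] have "3 dvd 2 * (c * b)"
    by (simp add: algebra_simps)
  moreover from dvd_diff[OF assms(2,1)] have "3 dvd 2 * (d * a)"
    by (simp add: algebra_simps)
  ultimately show ?thesis
    using assms(3,4) by (simp add: prime_dvd_mult_iff[OF three])
qed

text \<open>
  If 3 does not divide both coordinates, then \<open>3\<^sup>5\<close> divides one of the two products with \<open>z\<close> and
  its conjugate: their second coordinates \<open>y + 2x\<close> and \<open>y - 2x\<close> have product
  \<open>y\<^sup>2 - 4x\<^sup>2\<close>, and \<open>59(y\<^sup>2 - 4x\<^sup>2) = (7x\<^sup>2 + 59y\<^sup>2) - 3\<^sup>5x\<^sup>2\<close>.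
\<close>

lemma dvd_factor_form_7_59:
  fixes x y :: int
  assumes "7 * x ^ 2 + 59 * y ^ 2 = 3 ^ (n + 5)" and "\<not> (3 dvd x \<and> 3 dvd y)"
  shows "243 dvd y - 2 * x \<or> 243 dvd y + 2 * x"
proof -
  have "59 * ((y - 2 * x) * (y + 2 * x)) = 243 * (3 ^ n - x ^ 2)"
    using assms(1) by (simp add: algebra_simps power_add power2_eq_square)
  then have "243 dvd 59 * ((y - 2 * x) * (y + 2 * x))"
    by simp
  moreover have "coprime (3 ^ 5 :: int) 59"
    unfolding coprime_power_left_iff by (simp add: prime_imp_coprime)
  ultimately have "3 ^ 5 dvd (y - 2 * x) * (y + 2 * x)"
    by (simp add: coprime_dvd_mult_right_iff)
  moreover have "\<not> (3 dvd y - 2 * x \<and> 3 dvd y + 2 * x)"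
    using both_divisible_by_3[of 1 y 2 x] assms(2) by auto
  ultimately show ?thesis
    using prime_power_dvd_mult_cases[of 3 5 "y - 2 * x" "y + 2 * x"] by simp
qed

text \<open>
  The companion for the other form, where the products with \<open>z\<close> and its conjugate have second
  coordinates \<open>7v + 2u\<close> and \<open>7v - 2u\<close>; here
  \<open>49v\<^sup>2 - 4u\<^sup>2 = 7 \<cdot> 3\<^sup>5v\<^sup>2 - 4(u\<^sup>2 + 413v\<^sup>2)\<close>.
\<close>

lemma dvd_factor_form_1_413:
  fixes u v :: int
  assumes "u ^ 2 + 413 * v ^ 2 = 3 ^ (n + 5)" and "\<not> (3 dvd u \<and> 3 dvd v)"
  shows "243 dvd 7 * v - 2 * u \<or> 243 dvd 7 * v + 2 * u"
proof -
  have "(7 * v - 2 * u) * (7 * v + 2 * u) = 243 * (7 * v ^ 2 - 4 * 3 ^ n)"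
    using assms(1) by (simp add: algebra_simps power_add power2_eq_square)
  then have "3 ^ 5 dvd (7 * v - 2 * u) * (7 * v + 2 * u)"
    by simp
  moreover have "\<not> (3 dvd 7 * v - 2 * u \<and> 3 dvd 7 * v + 2 * u)"
    using both_divisible_by_3[of 7 v 2 u] assms(2) by auto
  ultimately show ?thesis
    using prime_power_dvd_mult_cases[of 3 5 "7 * v - 2 * u" "7 * v + 2 * u"] by simp
qed

text \<open>
  Division of \<open>x\<surd>7 + y\<surd>-59\<close> by \<open>z\<close>, that is, multiplication by the conjugate
  of \<open>z\<close> followed by division by \<open>3\<^sup>5\<close>.
\<close>

lemma descent_form_7_59:
  fixes x y :: int
  assumes "7 * x ^ 2 + 59 * y ^ 2 = 3 ^ (n + 5)" and "243 dvd y - 2 * x"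
  obtains u v :: int where "u ^ 2 + 413 * v ^ 2 = 3 ^ n" and "even v \<longleftrightarrow> even y"
proof -
  from assms(2) obtain v where v: "y - 2 * x = 243 * v"
    by (rule dvdE)
  then have y: "y = 2 * x + 243 * v"
    by simp
  \<comment> \<open>The other coordinate \<open>7x + 118y\<close> of the product is divisible by \<open>3\<^sup>5\<close> because
     \<open>7 + 2 \<cdot> 118 = 3\<^sup>5\<close>.\<close>
  define u where "u = x + 118 * v"
  have "u ^ 2 + 413 * v ^ 2 = 3 ^ n"
    using assms(1) unfolding y u_def
    by (simp add: algebra_simps power_add power2_eq_square)
  moreover have "even v \<longleftrightarrow> even y"
    by (simp add: y)
  ultimately show thesis
    by (rule that)
qed

text \<open>Division of \<open>u + v\<surd>-413\<close> by \<open>z\<close>.\<close>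

lemma descent_form_1_413:
  fixes u v :: int
  assumes "u ^ 2 + 413 * v ^ 2 = 3 ^ (n + 5)" and "243 dvd 7 * v - 2 * u"
  obtains x y :: int where "7 * x ^ 2 + 59 * y ^ 2 = 3 ^ n" and "even y \<longleftrightarrow> even v"
proof -
  from assms(2) obtain y where y: "7 * v - 2 * u = 243 * y"
    by (rule dvdE)
  \<comment> \<open>Twice the other coordinate, \<open>2(u + 118v) = 3\<^sup>5(v - y)\<close>, is divisible by \<open>3\<^sup>5\<close>, and
     \<open>v - y\<close> is even.\<close>
  have "even y \<longleftrightarrow> even v"
    using arg_cong[OF y, of even] by simp
  then obtain x where "v - y = 2 * x"
    using evenE[of "v - y"] by auto
  then have v: "v = y + 2 * x"
    by simp
  with y have u: "u = 7 * x - 118 * y"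
    by simp
  have "7 * x ^ 2 + 59 * y ^ 2 = 3 ^ n"
    using assms(1) unfolding v u
    by (simp add: algebra_simps power_add power2_eq_square)
  then show thesis
    using \<open>even y \<longleftrightarrow> even v\<close> by (rule that)
qed

lemma even_if_form_small:
  fixes x y :: int
  assumes "7 * x ^ 2 + 59 * y ^ 2 = 3 ^ m" and "m < 5"
  shows "even y"
proof (rule ccontr)
  assume "odd y"
  have "m = 0 \<or> m = 1 \<or> m = 2 \<or> m = 3 \<or> m = 4"
    using assms(2) by linarith
  then have pow: "(3 :: int) ^ m = 1 \<or> (3 :: int) ^ m = 3 \<or> (3 :: int) ^ m = 9 \<or>
      (3 :: int) ^ m = 27 \<or> (3 :: int) ^ m = 81"
    by auto
  then have "(3 :: int) ^ m \<le> 81"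
    by auto
  moreover have "0 \<le> 7 * x ^ 2"
    by simp
  ultimately have "y ^ 2 < 4"
    using assms(1) by linarith
  then have "\<bar>y\<bar> < 2"
    using power2_less_imp_less[of "\<bar>y\<bar>" 2] by simp
  then have "y = 1 \<or> y = - 1"
    using \<open>odd y\<close> by presburger
  then have "7 * x ^ 2 + 59 = 3 ^ m"
    using assms(1) by auto
  \<comment> \<open>Only 81 is at least 59, and \<open>81 - 59 = 22\<close> is not divisible by 7.\<close>
  with pow \<open>0 \<le> 7 * x ^ 2\<close> have "7 * x ^ 2 = 22"
    by linarith
  then show False
    by presburger
qed

lemma zero_if_form_1_413_small:
  fixes u v :: int
  assumes "u ^ 2 + 413 * v ^ 2 = 3 ^ m" and "m < 5"
  shows "v = 0"
proof -
  have "(3 :: int) ^ m \<le> 81"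
    using power_increasing[of m 4 "3 :: int"] assms(2) by simp
  moreover have "0 \<le> u ^ 2"
    by simp
  ultimately have "v ^ 2 \<le> 0"
    using assms(1) by linarith
  then show ?thesis
    by simp
qed

lemma form_divide_by_3:
  fixes a b s t :: int
  assumes "a * (3 * s) ^ 2 + b * (3 * t) ^ 2 = 3 ^ (n + 2)"
  shows "a * s ^ 2 + b * t ^ 2 = 3 ^ n"
proof -
  have "9 * (a * s ^ 2 + b * t ^ 2) = 9 * 3 ^ n"
    using assms by (simp add: algebra_simps power_add)
  then show ?thesis
    by simp
qed

text \<open>
  The simultaneous descent.  Conjugation, that is, a sign change of the first coordinate, reduces
  divisibility by the conjugate of \<open>z\<close> to divisibility by \<open>z\<close>.
\<close>

lemma second_coordinate_even:
  "(\<forall>x y :: int. 7 * x ^ 2 + 59 * y ^ 2 = 3 ^ m \<longrightarrow> even y) \<and>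
   (\<forall>u v :: int. u ^ 2 + 413 * v ^ 2 = 3 ^ m \<longrightarrow> even v)"
proof (induction m rule: less_induct)
  case (less m)
  show ?case
  proof (cases "m < 5")
    case True
    then show ?thesis
      using even_if_form_small zero_if_form_1_413_small by (metis even_zero)
  next
    case False
    define n where "n = m - 5"
    have m: "m = n + 5" and m': "m = (n + 3) + 2"
      using False by (auto simp: n_def)
    have IH1: "even y" if "7 * x ^ 2 + 59 * y ^ 2 = 3 ^ k" "k < m" for x y :: int and k
      using less.IH that by blast
    have IH2: "even v" if "u ^ 2 + 413 * v ^ 2 = 3 ^ k" "k < m" for u v :: int and k
      using less.IH that by blast
    have "even y" if eq: "7 * x ^ 2 + 59 * y ^ 2 = 3 ^ m" for x y :: int
    proof (cases "3 dvd x \<and> 3 dvd y")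
      case True
      then obtain s t where st: "x = 3 * s" "y = 3 * t"
        by (metis dvdE)
      have "7 * s ^ 2 + 59 * t ^ 2 = 3 ^ (n + 3)"
        using eq unfolding st m' by (rule form_divide_by_3)
      then have "even t"
        by (rule IH1) (simp add: m)
      then show ?thesis
        by (simp add: st)
    next
      case False
      have *: "even y" if "7 * a ^ 2 + 59 * y ^ 2 = 3 ^ (n + 5)" "243 dvd y - 2 * a" for a
        using descent_form_7_59[OF that] IH2 m by (metis less_add_same_cancel1 zero_less_numeral)
      show ?thesis
        using dvd_factor_form_7_59[OF eq[unfolded m] False] *[of x] *[of "- x"] eq[unfolded m]
        by auto
    qed
    moreover have "even v" if eq: "u ^ 2 + 413 * v ^ 2 = 3 ^ m" for u v :: int
    proof (cases "3 dvd u \<and> 3 dvd v")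
      case True
      then obtain s t where st: "u = 3 * s" "v = 3 * t"
        by (metis dvdE)
      have "1 * (3 * s) ^ 2 + 413 * (3 * t) ^ 2 = 3 ^ (n + 3 + 2)"
        using eq unfolding st m' by simp
      then have "1 * s ^ 2 + 413 * t ^ 2 = 3 ^ (n + 3)"
        by (rule form_divide_by_3)
      then have "even t"
        using IH2[of s t "n + 3"] by (simp add: m)
      then show ?thesis
        by (simp add: st)
    next
      case False
      have *: "even v" if "a ^ 2 + 413 * v ^ 2 = 3 ^ (n + 5)" "243 dvd 7 * v - 2 * a" for a
        using descent_form_1_413[OF that] IH1 m by (metis less_add_same_cancel1 zero_less_numeral)
      show ?thesis
        using dvd_factor_form_1_413[OF eq[unfolded m] False] *[of u] *[of "- u"] eq[unfolded m]
        by auto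
    qed
    ultimately show ?thesis
      by blast
  qed
qed

theorem proposition4:
  fixes x y m :: int
  assumes "is_solution x y m"
  shows "odd x \<and> even y"
proof -
  have eq: "7 * x ^ 2 + 59 * y ^ 2 = 3 ^ nat m"
    using assms by (simp add: is_solution_def)
  then have "even y"
    using second_coordinate_even by blast
  moreover have "odd (7 * x ^ 2 + 59 * y ^ 2)"
    unfolding eq by simp
  ultimately show ?thesis
    by auto
qed

end
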